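(* Let $\Sigma: x^+=f(x,u)$ be a discrete-time system with $f:\mathcal{X}\times\mathcal{U}\to\mathcal{X}$, $\mathcal{X}\subseteq\mathbb{R}^n$, $\mathcal{U}\subseteq\mathbb{R}^m$. Let $S_{xu}=S_x\times S_u\subseteq\mathcal{X}\times\mathcal{U}$ be a constraint set, let $\mathcal{D}$ be a finite data set for $\Sigma$ whose set of state-input pairs $\mathcal{D}_{xu}$ has (finite) dispersion $b$ in $S_{xu}$, let $\psi:\mathcal{X}\to\mathbb{R}^p$ be a lifting function, let $A\in\mathbb{R}^{p\times p}$ and $B\in\mathbb{R}^{p\times m}$ be matrices, and let $L_{E_{A,B}}$ be a Lipschitz constant of the error function $E_{A,B}(x,u)=\psi(f(x,u))-A\psi(x)-Bu$. Define $$e(A,B)=\min_{c\in\mathbb{R}^p}\ \max_{(\bar x,\bar u,\bar x^+)\in\mathcal{D}}\|\psi(\bar x^+)-A\psi(\bar x)-B\bar u-c\|,$$ with $c^*$ a minimizer, and let $\epsilon=L_{E_{A,B}}\,b+e(A,B)$. Then the linear system $\Sigma_{lin}: z^+=Az+Bu+w$ with $w\in W=\mathcal{B}(c^*,\epsilon)$ is a Koopman over-approximation of $\Sigma$ (with lifting function $\psi$) over $S_{xu}$; that is, $E_{A,B}(x,u)\in\mathcal{B}(c^*,\epsilon)$ for all $(x,u)\in S_{xu}$.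
   Context: Norms $\|\cdot\|$ on $\mathbb{R}^n\times\mathbb{R}^m$ and on $\mathbb{R}^p$ are fixed. $\mathcal{B}(c,r)$ is the closed norm ball with center $c$ and radius $r$. A Lipschitz constant of a function $h$ is a number $L_h\ge 0$ with $\|h(y)-h(y')\|\le L_h\|y-y'\|$ for all $y,y'$ in its domain; the function $E_{A,B}$ is considered on $\mathcal{X}\times\mathcal{U}$. Data set: $\mathcal{D}=\{(x_i,u_i,x_i^+)\}_{i=1}^N$, $N\ge1$, with $(x_i,u_i)\in\mathcal{X}\times\mathcal{U}$ and $x_i^+=f(x_i,u_i)$; $\mathcal{D}_{xu}=\{(x_i,u_i)\}_{i=1}^N$. It is not required that $\mathcal{D}_{xu}\subseteq S_{xu}$. Dispersion: the dispersion of $\mathcal{D}_{xu}$ in $S_{xu}$ is $b=\sup_{(x,u)\in S_{xu}}\min_{(\bar x,\bar u)\in\mathcal{D}_{xu}}\|(x,u)-(\bar x,\bar u)\|$. Koopman over-approximation: for an uncertain linear system $\Sigma_{lin}: z^+=Az+Bu+w$ with $z\in\mathbb{R}^p$, $u\in\mathcal{U}$, $w\in W\subseteq\mathbb{R}^p$, the pair $(\psi,\Sigma_{lin})$ (or simply $\Sigma_{lin}$) is a Koopman over-approximation of $\Sigma$ over $S_{xu}$ if $E_{A,B}(x,u)\in W$ for all $(x,u)\in S_{xu}$. *)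

theory Defs
  imports "HOL-Analysis.Analysis"
begin

text \<open>The norms are arbitrary ones, not the norms of the type classes, so balls and
  Lipschitz constants are taken with respect to explicit norm functions.\<close>

definition is_norm :: "('a::real_vector \<Rightarrow> real) \<Rightarrow> bool" where
  "is_norm N \<longleftrightarrow>
     (\<forall>x. 0 \<le> N x) \<and> (\<forall>x. N x = 0 \<longleftrightarrow> x = 0) \<and>
     (\<forall>a x. N (a *\<^sub>R x) = \<bar>a\<bar> * N x) \<and> (\<forall>x y. N (x + y) \<le> N x + N y)"

definition norm_cball :: "('a::real_vector \<Rightarrow> real) \<Rightarrow> 'a \<Rightarrow> real \<Rightarrow> 'a set" where
  "norm_cball N c r = {z. N (z - c) \<le> r}"

definition lipschitz_constant ::
    "('a::real_vector \<Rightarrow> real) \<Rightarrow> ('b::real_vector \<Rightarrow> real) \<Rightarrow> 'a set \<Rightarrow> ('a \<Rightarrow> 'b) \<Rightarrow> real \<Rightarrow> bool" where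
  "lipschitz_constant N N' S h L \<longleftrightarrow>
     0 \<le> L \<and> (\<forall>y\<in>S. \<forall>y'\<in>S. N' (h y - h y') \<le> L * N (y - y'))"

definition data_set ::
    "('x \<times> 'u \<Rightarrow> 'x) \<Rightarrow> 'x set \<Rightarrow> 'u set \<Rightarrow> ('x \<times> 'u \<times> 'x) set \<Rightarrow> bool" where
  "data_set f X U D \<longleftrightarrow>
     finite D \<and> D \<noteq> {} \<and> (\<forall>(x, u, xp)\<in>D. (x, u) \<in> X \<times> U \<and> xp = f (x, u))"

definition data_xu :: "('x \<times> 'u \<times> 'x) set \<Rightarrow> ('x \<times> 'u) set" where
  "data_xu D = (\<lambda>(x, u, xp). (x, u)) ` D"

text \<open>Extended values: the supremum is infinite for unbounded distances, and 0 if the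
  constraint set is empty.\<close>

definition dispersion :: "('a::real_vector \<Rightarrow> real) \<Rightarrow> 'a set \<Rightarrow> 'a set \<Rightarrow> ennreal" where
  "dispersion N P S = (SUP s\<in>S. ennreal (MIN d\<in>P. N (s - d)))"

definition lifting_error ::
    "('x \<times> (real ^ 'm) \<Rightarrow> 'x) \<Rightarrow> ('x \<Rightarrow> real ^ 'p) \<Rightarrow> real ^ 'p ^ 'p \<Rightarrow> real ^ 'm ^ 'p
      \<Rightarrow> 'x \<times> (real ^ 'm) \<Rightarrow> real ^ 'p" where
  "lifting_error f \<psi> A B = (\<lambda>(x, u). \<psi> (f (x, u)) - A *v \<psi> x - B *v u)"

definition max_residual ::
    "(real ^ 'p \<Rightarrow> real) \<Rightarrow> ('x \<Rightarrow> real ^ 'p) \<Rightarrow> ('x \<times> (real ^ 'm) \<times> 'x) set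
      \<Rightarrow> real ^ 'p ^ 'p \<Rightarrow> real ^ 'm ^ 'p \<Rightarrow> real ^ 'p \<Rightarrow> real" where
  "max_residual N \<psi> D A B c = (MAX (x, u, xp)\<in>D. N (\<psi> xp - A *v \<psi> x - B *v u - c))"

text \<open>The infimum is a minimum, by \<open>ex_max_residual_minimizer\<close> below.\<close>

definition min_max_residual ::
    "(real ^ 'p \<Rightarrow> real) \<Rightarrow> ('x \<Rightarrow> real ^ 'p) \<Rightarrow> ('x \<times> (real ^ 'm) \<times> 'x) set
      \<Rightarrow> real ^ 'p ^ 'p \<Rightarrow> real ^ 'm ^ 'p \<Rightarrow> real" where
  "min_max_residual N \<psi> D A B = (INF c. max_residual N \<psi> D A B c)"

text \<open>\<open>A\<close>, \<open>B\<close>, \<open>W\<close> stand for the uncertain linear system \<open>z\<^sup>+ = A z + B u + w\<close>, \<open>w \<in> W\<close>.\<close>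

definition koopman_over_approximation ::
    "('x \<times> (real ^ 'm) \<Rightarrow> 'x) \<Rightarrow> ('x \<Rightarrow> real ^ 'p) \<Rightarrow> real ^ 'p ^ 'p \<Rightarrow> real ^ 'm ^ 'p
      \<Rightarrow> (real ^ 'p) set \<Rightarrow> ('x \<times> (real ^ 'm)) set \<Rightarrow> bool" where
  "koopman_over_approximation f \<psi> A B W S \<longleftrightarrow>
     (\<forall>(x, u)\<in>S. lifting_error f \<psi> A B (x, u) \<in> W)"

lemma is_norm_continuous_on:
  fixes N :: "'a::euclidean_space \<Rightarrow> real"
  assumes "is_norm N"
  shows "continuous_on UNIV N"
proof (rule convex_on_continuous)
  show "convex_on UNIV N"
  proof (rule convex_onI)
    fix t :: real and x y :: 'a
    assume t: "0 < t" "t < 1"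
    have "N ((1 - t) *\<^sub>R x + t *\<^sub>R y) \<le> N ((1 - t) *\<^sub>R x) + N (t *\<^sub>R y)"
      using assms unfolding is_norm_def by blast
    also have "\<dots> = \<bar>1 - t\<bar> * N x + \<bar>t\<bar> * N y"
      using assms unfolding is_norm_def by simp
    finally show "N ((1 - t) *\<^sub>R x + t *\<^sub>R y) \<le> (1 - t) * N x + t * N y"
      using t by simp
  qed simp
qed simp

lemma is_norm_ge_norm:
  fixes N :: "'a::euclidean_space \<Rightarrow> real"
  assumes "is_norm N"
  obtains k where "k > 0" "\<And>x. k * norm x \<le> N x"
proof -
  have "compact (sphere (0::'a) 1)" by simp
  moreover have "sphere (0::'a) 1 \<noteq> {}" by simp
  moreover have "continuous_on (sphere 0 1) N"
    using is_norm_continuous_on[OF assms] continuous_on_subset by blast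
  ultimately have "\<exists>s\<in>sphere 0 1. \<forall>y\<in>sphere 0 1. N s \<le> N y"
    by (rule continuous_attains_inf)
  then obtain s where s: "s \<in> sphere 0 1" "\<And>y. y \<in> sphere 0 1 \<Longrightarrow> N s \<le> N y"
    by blast
  have "s \<noteq> 0" using s(1) by auto
  then have "N s \<noteq> 0" "0 \<le> N s" using assms unfolding is_norm_def by blast+
  then have "N s > 0" by simp
  moreover have "N s * norm x \<le> N x" for x
  proof (cases "x = 0")
    case True
    then show ?thesis using assms unfolding is_norm_def by auto
  next
    case False
    then have "N s \<le> N ((1 / norm x) *\<^sub>R x)" by (intro s(2)) simp
    also have "\<dots> = (1 / norm x) * N x" using assms unfolding is_norm_def by simp
    finally show ?thesis using False by (simp add: field_simps)
  qed
  ultimately show ?thesis using that by blast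
qed

lemma continuous_on_Max_image:
  fixes g :: "'i \<Rightarrow> 'a::topological_space \<Rightarrow> real"
  assumes "finite D" "D \<noteq> {}" "\<And>d. d \<in> D \<Longrightarrow> continuous_on S (g d)"
  shows "continuous_on S (\<lambda>c. MAX d\<in>D. g d c)"
  using assms
proof (induction D rule: finite_ne_induct)
  case (insert d D)
  then have "(\<lambda>c. MAX d\<in>insert d D. g d c) = (\<lambda>c. max (g d c) (MAX d\<in>D. g d c))"
    by (auto simp: fun_eq_iff)
  with insert show ?case by (auto intro!: continuous_on_max)
qed simp

lemma ex_max_residual_minimizer:
  assumes N: "is_norm N" and D: "finite D" "D \<noteq> {}"
  shows "\<exists>c. is_arg_min (max_residual N \<psi> D A B) (\<lambda>_. True) c"
proof -
  let ?m = "max_residual N \<psi> D A B"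
  define a where "a = (\<lambda>(x, u, xp). \<psi> xp - A *v \<psi> x - B *v u)"
  have m: "?m = (\<lambda>c. MAX d\<in>D. N (a d - c))"
    unfolding max_residual_def a_def by (simp add: fun_eq_iff case_prod_unfold)
  obtain k where k: "k > 0" "\<And>x. k * norm x \<le> N x" using is_norm_ge_norm[OF N] by blast
  obtain d where d: "d \<in> D" using D by blast
  have low: "k * dist (a d) c \<le> ?m c" for c
  proof -
    have "N (a d - c) \<le> ?m c" unfolding m using D d by (auto intro: Max_ge)
    with k(2)[of "a d - c"] show ?thesis by (simp add: dist_norm)
  qed
  have "continuous_on S (\<lambda>c. N (a e - c))" for S e
    using continuous_on_compose2[OF is_norm_continuous_on[OF N], of S "\<lambda>c. a e - c"]
    by (simp add: continuous_on_diff)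
  then have cont: "continuous_on (cball (a d) (?m (a d) / k)) ?m"
    unfolding m by (intro continuous_on_Max_image D)
  have "0 \<le> ?m (a d) / k" using low[of "a d"] k(1) by simp
  then have in_ball: "a d \<in> cball (a d) (?m (a d) / k)" by simp
  then have "cball (a d) (?m (a d) / k) \<noteq> {}" by blast
  then have "\<exists>c\<in>cball (a d) (?m (a d) / k). \<forall>y\<in>cball (a d) (?m (a d) / k). ?m c \<le> ?m y"
    by (intro continuous_attains_inf compact_cball cont)
  then obtain c where c: "\<And>y. y \<in> cball (a d) (?m (a d) / k) \<Longrightarrow> ?m c \<le> ?m y"
    by blast
  have "?m c \<le> ?m y" for y
  proof (cases "y \<in> cball (a d) (?m (a d) / k)")
    case False
    then have "?m (a d) < k * dist (a d) y" using k(1) by (simp add: field_simps)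
    with low[of y] c[OF in_ball] show ?thesis by linarith
  qed (rule c)
  then show ?thesis unfolding is_arg_min_linorder by blast
qed

lemma min_max_residual_eq:
  assumes "is_arg_min (max_residual N \<psi> D A B) (\<lambda>_. True) c"
  shows "min_max_residual N \<psi> D A B = max_residual N \<psi> D A B c"
  using assms unfolding min_max_residual_def is_arg_min_linorder
  by (intro cInf_eq_minimum) auto

end

theory Submission
  imports Defs
begin

text \<open>A point of the constraint set has a data point within distance \<open>b\<close>. The error moves by at
  most \<open>L * b\<close> from one to the other, and at a data point it is a residual, hence within
  \<open>e(A, B)\<close> of the Chebyshev centre \<open>c\<close>.\<close>

text \<open>Over a finite nonempty \<open>P\<close> the minimum distance is attained, so a bound on
  the supremum of these minima yields an actual point of \<open>P\<close> and needs no
  slack.\<close>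

lemma dispersion_le_imp_near:
  assumes "finite P" "P \<noteq> {}" "0 \<le> b" "dispersion N P S \<le> ennreal b" "s \<in> S"
  obtains d where "d \<in> P" "N (s - d) \<le> b"
proof -
  have "ennreal (MIN d\<in>P. N (s - d)) \<le> dispersion N P S"
    unfolding dispersion_def using assms(5) by (rule SUP_upper)
  with assms(4) have "ennreal (MIN d\<in>P. N (s - d)) \<le> ennreal b"
    by (rule order_trans[rotated])
  \<comment> \<open>\<open>ennreal\<close> sends negative reals to 0, so the order passes back to
    the reals because \<open>b\<close> is nonnegative.\<close>
  with assms(3) have "(MIN d\<in>P. N (s - d)) \<le> b"
    by (simp add: ennreal_le_iff)
  moreover have "(MIN d\<in>P. N (s - d)) \<in> (\<lambda>d. N (s - d)) ` P"
    using assms(1,2) by (intro Min_in) auto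
  ultimately show thesis
    using that by auto
qed

text \<open>Recorded successors satisfy \<open>xp = f (x, u)\<close>, so the error at a data pair,
  shifted by \<open>c\<close>, is among the finitely many vectors whose norms are maximized.\<close>

lemma lifting_error_data_le_max_residual:
  assumes "data_set f X U D" "d \<in> data_xu D"
  shows "N (lifting_error f \<psi> A B d - c) \<le> max_residual N \<psi> D A B c"
proof -
  obtain x u xp where d: "(x, u, xp) \<in> D" "d = (x, u)"
    using assms(2) unfolding data_xu_def by auto
  have "finite D" "xp = f (x, u)"
    using assms(1) d(1) unfolding data_set_def by auto
  then show ?thesis
    unfolding max_residual_def lifting_error_def d(2)
    by (intro Max_ge) (auto intro!: image_eqI[OF _ d(1)])
qed

theorem theorem3:
  fixes normY :: "(real ^ 'n) \<times> (real ^ 'm) \<Rightarrow> real"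
    and normZ :: "real ^ 'p \<Rightarrow> real"
    and X Sx :: "(real ^ 'n) set" and U Su :: "(real ^ 'm) set"
    and f :: "(real ^ 'n) \<times> (real ^ 'm) \<Rightarrow> real ^ 'n"
    and D :: "((real ^ 'n) \<times> (real ^ 'm) \<times> (real ^ 'n)) set"
    and \<psi> :: "real ^ 'n \<Rightarrow> real ^ 'p"
    and A :: "real ^ 'p ^ 'p" and B :: "real ^ 'm ^ 'p"
    and b L \<epsilon> :: real and c :: "real ^ 'p"
  assumes "is_norm normY" and "is_norm normZ"
    and "f \<in> X \<times> U \<rightarrow> X"
    and "Sx \<times> Su \<subseteq> X \<times> U"
    and "data_set f X U D"
    and "0 \<le> b" and "dispersion normY (data_xu D) (Sx \<times> Su) = ennreal b"
    and "lipschitz_constant normY normZ (X \<times> U) (lifting_error f \<psi> A B) L"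
    and "is_arg_min (max_residual normZ \<psi> D A B) (\<lambda>_. True) c"
    and "\<epsilon> = L * b + min_max_residual normZ \<psi> D A B"
  shows "koopman_over_approximation f \<psi> A B (norm_cball normZ c \<epsilon>) (Sx \<times> Su)"
proof -
  have P: "finite (data_xu D)" "data_xu D \<noteq> {}" "data_xu D \<subseteq> X \<times> U"
    using assms(5) unfolding data_set_def data_xu_def by auto
  let ?E = "lifting_error f \<psi> A B"
  have "normZ (?E s - c) \<le> \<epsilon>" if s: "s \<in> Sx \<times> Su" for s
  proof -
    obtain d where d: "d \<in> data_xu D" "normY (s - d) \<le> b"
      using dispersion_le_imp_near[OF P(1,2) assms(6) _ s] assms(7) by (metis order_refl)
    \<comment> \<open>The data point \<open>d\<close> may lie outside \<open>Sx \<times> Su\<close>;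
      the Lipschitz bound still applies, since \<open>s\<close> and \<open>d\<close> both lie in
      \<open>X \<times> U\<close>.\<close>
    have L: "0 \<le> L" "normZ (?E s - ?E d) \<le> L * normY (s - d)"
      using assms(4,8) P(3) s d(1) unfolding lipschitz_constant_def by blast+
    have "normZ (?E s - c) = normZ ((?E s - ?E d) + (?E d - c))"
      by simp
    also have "\<dots> \<le> normZ (?E s - ?E d) + normZ (?E d - c)"
      using assms(2) unfolding is_norm_def by blast
    also have "\<dots> \<le> L * b + max_residual normZ \<psi> D A B c"
      using L mult_left_mono[OF d(2) L(1)] lifting_error_data_le_max_residual[OF assms(5) d(1)]
      by (intro add_mono) auto
    \<comment> \<open>Minimality of \<open>c\<close> turns its maximal residual into the infimum
      that occurs in \<open>\<epsilon>\<close>.\<close>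
    finally show ?thesis
      using assms(10) min_max_residual_eq[OF assms(9)] by simp
  qed
  then show ?thesis
    unfolding koopman_over_approximation_def norm_cball_def by auto
qed

end
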